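(* Let $k\ge 2$ and let $m_1,\dots,m_k\ge 2$ be integers satisfying $\sum_{i=1}^k 1/m_i<1$. Then $$C_k\le \prod_{i=1}^k m_i+\sum_{i=1}^k m_i,$$ and $$\mathrm{HGP}(B_{k,n})\le \prod_{i=1}^k m_i+\sum_{i=1}^k m_i\qquad\text{for every } n\ge 1 .$$
   Context: Proper hat-guessing game: let $G=(V,E)$ be a finite simple graph and $[q]=\{0,1,\dots,q-1\}$. Before play, the vertices agree on deterministic guess functions; the guess of each vertex is a function of the colors on its open neighborhood, with values in $[q]$. An adversary assigns a color from $[q]$ to every vertex so that adjacent vertices get distinct colors (a proper $q$-coloring). All vertices simultaneously guess their own colors. A strategy (family of guess functions) is winning with $q$ colors if for every proper $q$-coloring at least one vertex guesses its own color correctly. The proper hat-guessing number $\mathrm{HGP}(G)$ is the largest $q$ for which a winning strategy exists. The book graph is $B_{k,n}=K_k\vee\overline{K_n}$ (join): $k$ mutually adjacent vertices (spines) and $n$ pairwise nonadjacent vertices (pages), every page adjacent to every spine. A proper $k$-tuple is a $k$-tuple $\boldsymbol{x}=(x_1,\dots,x_k)$ of pairwise distinct colors; a configuration is a set $P$ of proper $k$-tuples, with colors drawn from some finite set. Let $\pi_i(\boldsymbol{x})$ be the $(k-1)$-tuple obtained by deleting coordinate $i$. A set $A$ of proper $k$-tuples is $i$-saturated if $\pi_i$ restricted to $A$ is injective. A configuration $P$ is coverable if it can be partitioned as $P=P_1\,\dot\cup\cdots\dot\cup\,P_k$ (parts may be empty) with $P_i$ being $i$-saturated for every $i$. Let $\mathrm{supp}(P)=\bigcup_{\boldsymbol{x}\in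 P}\{x_1,\dots,x_k\}$. Define $$C_k=\min\{|P|+|\mathrm{supp}(P)| : P \text{ is a finite non-coverable configuration of proper } k\text{-tuples}\},$$ where the colors may be drawn from any finite set. *)

theory Defs
  imports Complex_Main "HOL-Library.FuncSet" "HOL-Library.Disjoint_Sets"
    "Graph_Theory.Pair_Digraph"
begin

section \<open>The proper hat-guessing game\<close>

text \<open>
  A finite simple graph is a \<^locale>\<open>pair_graph\<close>: a finite, loop-free digraph without parallel arcs
  whose arc relation is symmetric. The colour set with \<open>q\<close> colours is \<open>{..<q}\<close>.
\<close>

definition nbhd :: "'a pair_pre_digraph \<Rightarrow> 'a \<Rightarrow> 'a set" where
  "nbhd G v = {u \<in> pverts G. (v, u) \<in> parcs G}"

definition proper_colouring :: "'a pair_pre_digraph \<Rightarrow> nat \<Rightarrow> ('a \<Rightarrow> nat) \<Rightarrow> bool" where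
  "proper_colouring G q c \<longleftrightarrow>
     c \<in> pverts G \<rightarrow>\<^sub>E {..<q} \<and> (\<forall>(u, v) \<in> parcs G. c u \<noteq> c v)"

text \<open>
  A guess function takes the colours on the open neighbourhood only: its argument is an
  (extensional) function on \<open>nbhd G v\<close>. That colouring need not extend to a proper colouring of \<open>G\<close>;
  the values of the guess function on such arguments play no role in the game.
\<close>

definition strategy ::
  "'a pair_pre_digraph \<Rightarrow> nat \<Rightarrow> ('a \<Rightarrow> ('a \<Rightarrow> nat) \<Rightarrow> nat) \<Rightarrow> bool" where
  "strategy G q g \<longleftrightarrow> (\<forall>v \<in> pverts G. g v \<in> (nbhd G v \<rightarrow>\<^sub>E {..<q}) \<rightarrow> {..<q})"

definition winning_strategy ::
  "'a pair_pre_digraph \<Rightarrow> nat \<Rightarrow> ('a \<Rightarrow> ('a \<Rightarrow> nat) \<Rightarrow> nat) \<Rightarrow> bool" where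
  "winning_strategy G q g \<longleftrightarrow> strategy G q g \<and>
     (\<forall>c. proper_colouring G q c \<longrightarrow> (\<exists>v \<in> pverts G. g v (restrict c (nbhd G v)) = c v))"

definition HGP :: "'a pair_pre_digraph \<Rightarrow> nat" where
  "HGP G = (GREATEST q. \<exists>g. winning_strategy G q g)"


section \<open>Book graphs\<close>

definition complete_graph :: "nat \<Rightarrow> nat pair_pre_digraph" where
  "complete_graph k = \<lparr>pverts = {..<k}, parcs = {(u, v). u < k \<and> v < k \<and> u \<noteq> v}\<rparr>"

definition edgeless_graph :: "nat \<Rightarrow> nat pair_pre_digraph" where
  "edgeless_graph n = \<lparr>pverts = {..<n}, parcs = {}\<rparr>"

definition graph_join ::
  "'a pair_pre_digraph \<Rightarrow> 'b pair_pre_digraph \<Rightarrow> ('a + 'b) pair_pre_digraph" where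
  "graph_join G H =
     \<lparr>pverts = pverts G <+> pverts H,
      parcs = map_prod Inl Inl ` parcs G \<union> map_prod Inr Inr ` parcs H
        \<union> (Inl ` pverts G) \<times> (Inr ` pverts H) \<union> (Inr ` pverts H) \<times> (Inl ` pverts G)\<rparr>"

definition book_graph :: "nat \<Rightarrow> nat \<Rightarrow> (nat + nat) pair_pre_digraph" where
  "book_graph k n = graph_join (complete_graph k) (edgeless_graph n)"

lemma pair_graph_book_graph: "pair_graph (book_graph k n)"
proof
  let ?G = "book_graph k n"
  have parcs: "parcs ?G \<subseteq> pverts ?G \<times> pverts ?G"
    by (auto simp: book_graph_def graph_join_def complete_graph_def edgeless_graph_def)
  show fin: "finite (pverts ?G)"
    by (auto simp: book_graph_def graph_join_def complete_graph_def edgeless_graph_def)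
  show "finite (parcs ?G)"
    using finite_subset[OF parcs] fin by blast
  show "fst e \<in> pverts ?G" "snd e \<in> pverts ?G" if "e \<in> parcs ?G" for e
    using that parcs by auto
  show "fst e \<noteq> snd e" if "e \<in> parcs ?G" for e
    using that by (auto simp: book_graph_def graph_join_def complete_graph_def edgeless_graph_def)
  show "symmetric (with_proj ?G)"
    by (force simp: symmetric_def sym_def book_graph_def graph_join_def complete_graph_def
        edgeless_graph_def)
qed


section \<open>Configurations and coverability\<close>

text \<open>
  Tuples are lists, with coordinates indexed by \<open>0, \<dots>, k - 1\<close>. Colours are natural numbers: every
  finite colour set embeds into \<^typ>\<open>nat\<close>, and neither the cardinalities nor coverability change
  under an injective renaming of colours.
\<close>

definition proper_tuples :: "nat \<Rightarrow> nat list set" where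
  "proper_tuples k = {x. length x = k \<and> distinct x}"

definition delete_coord :: "nat \<Rightarrow> 'a list \<Rightarrow> 'a list" where
  "delete_coord i x = take i x @ drop (Suc i) x"

definition saturated :: "nat \<Rightarrow> 'a list set \<Rightarrow> bool" where
  "saturated i A \<longleftrightarrow> inj_on (delete_coord i) A"

definition coverable :: "nat \<Rightarrow> 'a list set \<Rightarrow> bool" where
  "coverable k P \<longleftrightarrow>
     (\<exists>Q. (\<Union>i<k. Q i) = P \<and> disjoint_family_on Q {..<k} \<and> (\<forall>i<k. saturated i (Q i)))"

definition supp :: "'a list set \<Rightarrow> 'a set" where
  "supp P = (\<Union>x\<in>P. set x)"

definition C :: "nat \<Rightarrow> nat" where
  "C k = (LEAST N. \<exists>P. finite P \<and> P \<subseteq> proper_tuples k \<and> \<not> coverable k P \<and>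
            N = card P + card (supp P))"

end

theory Submission
  imports Defs
begin

text \<open>
  Take pairwise disjoint sets of \<open>m\<^sub>1, \<dots>, m\<^sub>k\<close> colours and let \<open>P\<close> be their product. An
  \<open>i\<close>-saturated subset of \<open>P\<close> has at most \<open>|P| / m\<^sub>i\<close> elements, so \<open>\<Sum> 1 / m\<^sub>i < 1\<close> makes \<open>P\<close>
  non-coverable. If there are more than \<open>|P| + |supp P|\<close> colours, the adversary gives each page one
  colour that is outside \<open>supp P\<close> and that the page never guesses while the spines are coloured
  from \<open>P\<close>. With the pages fixed, the tuples of \<open>P\<close> on which spine \<open>i\<close> guesses correctly are
  \<open>i\<close>-saturated, so some tuple of \<open>P\<close> defeats all the spines as well.
\<close>

section \<open>Coordinate deletion and coverability\<close>

lemma list_update_eq_if_delete_coord_eq: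
  assumes "delete_coord i x = delete_coord i y" "length x = length y" "i < length x"
  shows "y[i := x ! i] = x"
proof -
  have "take i x = take i y" "drop (Suc i) x = drop (Suc i) y"
    using assms by (auto simp: delete_coord_def)
  then show ?thesis
    using assms id_take_nth_drop[of i x] upd_conv_take_nth_drop[of i y "x ! i"] by simp
qed

text \<open>Saturation passes to subsets, so overlaps can be removed with \<open>disjointed\<close>.
  This matters in the game, where several spines may guess correctly on the same tuple.\<close>

lemma coverable_if_covered:
  assumes "P = (\<Union>i<k. Q i)" and "\<And>i. i < k \<Longrightarrow> saturated i (Q i)"
  shows "coverable k P"
  unfolding coverable_def
proof (intro exI conjI allI impI)
  show "(\<Union>i<k. disjointed Q i) = P"
    using finite_UN_disjointed_eq[of Q k] assms(1) by (simp add: atLeast0LessThan)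
  show "disjoint_family_on (disjointed Q) {..<k}"
    using disjoint_family_disjointed[of Q] by (rule disjoint_family_on_mono[rotated]) simp
  show "saturated i (disjointed Q i)" if "i < k" for i
    using assms(2)[OF that] disjointed_subset[of Q i] unfolding saturated_def
    by (rule inj_on_subset)
qed

subsection \<open>Product configurations\<close>

definition product_config :: "nat \<Rightarrow> (nat \<Rightarrow> 'a set) \<Rightarrow> 'a list set" where
  "product_config k S = (\<lambda>f. map f [0..<k]) ` (\<Pi>\<^sub>E i\<in>{..<k}. S i)"

lemma card_product_config: "card (product_config k S) = (\<Prod>i<k. card (S i))"
proof -
  have "inj_on (\<lambda>f. map f [0..<k]) (\<Pi>\<^sub>E i\<in>{..<k}. S i)"
    by (intro inj_onI PiE_ext[where k = "{..<k}" and s = S]) auto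
  then show ?thesis
    by (simp add: product_config_def card_image card_PiE)
qed

lemma finite_product_config:
  "(\<And>i. i < k \<Longrightarrow> finite (S i)) \<Longrightarrow> finite (product_config k S)"
  unfolding product_config_def by (intro finite_imageI finite_PiE) auto

lemma supp_product_config_subset: "supp (product_config k S) \<subseteq> (\<Union>i<k. S i)"
  by (fastforce simp: supp_def product_config_def)

lemma product_config_proper:
  assumes "disjoint_family_on S {..<k}"
  shows "product_config k S \<subseteq> proper_tuples k"
proof
  fix x assume "x \<in> product_config k S"
  then obtain f where f: "f \<in> (\<Pi>\<^sub>E i\<in>{..<k}. S i)" and x: "x = map f [0..<k]"
    by (auto simp: product_config_def)
  have "inj_on f {..<k}"
  proof (rule inj_onI)
    fix i j assume ij: "i \<in> {..<k}" "j \<in> {..<k}" "f i = f j"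
    then have "f i \<in> S i \<inter> S j"
      using f by (metis IntI PiE_mem)
    then show "i = j"
      using assms ij by (auto simp: disjoint_family_on_def)
  qed
  then show "x \<in> proper_tuples k"
    by (simp add: x proper_tuples_def distinct_map atLeast0LessThan)
qed

lemma delete_coord_map: "delete_coord i (map f xs) = map f (delete_coord i xs)"
  by (simp add: delete_coord_def take_map drop_map)

text \<open>Deleting entry \<open>i\<close> is injective on \<open>A\<close> and lands in the
  product of the remaining factors.\<close>

lemma card_saturated_le:
  assumes "A \<subseteq> product_config k S" "saturated i A" "i < k" "\<And>j. j < k \<Longrightarrow> finite (S j)"
  shows "card A \<le> (\<Prod>j\<in>{..<k} - {i}. card (S j))"
proof -
  let ?I = "{..<k} - {i}"
  let ?F = "\<lambda>f. map f (delete_coord i [0..<k])"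
  have fin: "finite (PiE ?I S)"
    using assms(4) by (intro finite_PiE) auto
  have del: "set (delete_coord i [0..<k]) = ?I"
    using assms(3) by (auto simp: delete_coord_def drop_upt)
  have "delete_coord i ` A \<subseteq> ?F ` PiE ?I S"
  proof
    fix z assume "z \<in> delete_coord i ` A"
    then obtain f where f: "f \<in> (\<Pi>\<^sub>E j\<in>{..<k}. S j)" and z: "z = ?F f"
      using assms(1) by (auto simp: product_config_def delete_coord_map)
    \<comment> \<open>Membership in \<open>PiE ?I S\<close> requires the value at \<open>i\<close>
      to be undefined; the shortened list does not see that value.\<close>
    have "z = ?F (restrict f ?I)"
      unfolding z by (rule map_cong[OF refl]) (simp add: del)
    moreover have "restrict f ?I \<in> PiE ?I S"
      using f by auto
    ultimately show "z \<in> ?F ` PiE ?I S" by blast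
  qed
  then have "card (delete_coord i ` A) \<le> card (PiE ?I S)"
    by (meson fin card_image_le card_mono finite_imageI le_trans)
  then show ?thesis
    using assms(2) by (simp add: saturated_def card_image card_PiE)
qed

lemma product_config_not_coverable:
  assumes fin: "\<And>i. i < k \<Longrightarrow> finite (S i)" and ne: "\<And>i. i < k \<Longrightarrow> S i \<noteq> {}"
    and sum: "(\<Sum>i<k. 1 / real (card (S i))) < 1"
  shows "\<not> coverable k (product_config k S)"
proof
  let ?N = "\<Prod>i<k. card (S i)"
  have pos: "card (S i) > 0" if "i < k" for i
    using fin ne that by (simp add: card_gt_0_iff)
  assume "coverable k (product_config k S)"
  then obtain Q where Q: "(\<Union>i<k. Q i) = product_config k S" "\<And>i. i < k \<Longrightarrow> saturated i (Q i)"
    by (auto simp: coverable_def)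
  have part: "real (card (Q i)) \<le> real ?N * (1 / real (card (S i)))" if "i < k" for i
  proof -
    have "card (Q i) \<le> (\<Prod>j\<in>{..<k} - {i}. card (S j))"
      using Q fin that by (intro card_saturated_le) auto
    moreover have "?N = card (S i) * (\<Prod>j\<in>{..<k} - {i}. card (S j))"
      using that by (intro prod.remove) auto
    ultimately show ?thesis
      using pos[OF that] by (simp del: of_nat_prod)
  qed
  have "real ?N = real (card (\<Union>i<k. Q i))"
    by (simp only: Q(1) card_product_config)
  also have "\<dots> \<le> (\<Sum>i<k. real (card (Q i)))"
    using card_UN_le[of "{..<k}" Q] by (simp flip: of_nat_sum)
  also have "\<dots> \<le> real ?N * (\<Sum>i<k. 1 / real (card (S i)))"
    unfolding sum_distrib_left using part by (intro sum_mono) auto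
  \<comment> \<open>Strictness relies on \<open>?N > 0\<close>, that is, on all factors being
    nonempty.\<close>
  also have "\<dots> < real ?N * 1"
    using pos sum by (intro mult_strict_left_mono) (auto intro!: prod_pos)
  finally show False by simp
qed

lemma C_le:
  assumes "finite P" "P \<subseteq> proper_tuples k" "\<not> coverable k P"
  shows "C k \<le> card P + card (supp P)"
  unfolding C_def using assms by (intro Least_le) blast

subsection \<open>The game on book graphs\<close>

lemma pverts_book_graph: "pverts (book_graph k n) = {..<k} <+> {..<n}"
  by (simp add: book_graph_def graph_join_def complete_graph_def edgeless_graph_def)

lemma nbhd_book_graph_spine:
  "i < k \<Longrightarrow> nbhd (book_graph k n) (Inl i) = ({..<k} - {i}) <+> {..<n}"
  by (auto simp: nbhd_def book_graph_def graph_join_def complete_graph_def edgeless_graph_def)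

lemma nbhd_book_graph_page:
  "j < n \<Longrightarrow> nbhd (book_graph k n) (Inr j) = Inl ` {..<k}"
  by (auto simp: nbhd_def book_graph_def graph_join_def complete_graph_def edgeless_graph_def)

lemma nbhd_subset_pverts: "nbhd G v \<subseteq> pverts G"
  by (auto simp: nbhd_def)

lemma book_graph_no_winning_strategy:
  assumes finP: "finite P" and P: "P \<subseteq> proper_tuples k" and ncov: "\<not> coverable k P"
    and supp: "supp P \<subseteq> {..<q}" and q: "card P + card (supp P) < q"
  shows "\<not> winning_strategy (book_graph k n) q g"
proof
  let ?G = "book_graph k n"
  assume "winning_strategy ?G q g"
  then have win: "\<exists>v \<in> pverts ?G. g v (restrict c (nbhd ?G v)) = c v" if "proper_colouring ?G q c" for c
    using that by (simp add: winning_strategy_def)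
  \<comment> \<open>The guess of page \<open>j\<close> when the spines carry \<open>x\<close>. A
    page sees only spines, so the default colour 0 for pages is never read.\<close>
  define pg where "pg j x = g (Inr j) (restrict (case_sum ((!) x) (\<lambda>_. 0)) (nbhd ?G (Inr j)))" for j x
  have "\<exists>y<q. y \<notin> supp P \<and> y \<notin> pg j ` P" for j
  proof (rule ccontr)
    assume "\<not> ?thesis"
    then have "{..<q} \<subseteq> supp P \<union> pg j ` P" by auto
    moreover have "finite (supp P)"
      using finP by (simp add: supp_def)
    ultimately have "q \<le> card (supp P \<union> pg j ` P)"
      using finP card_mono[of "supp P \<union> pg j ` P" "{..<q}"] by simp
    also have "\<dots> \<le> card (supp P) + card P"
      using card_Un_le[of "supp P" "pg j ` P"] card_image_le[OF finP, of "pg j"] by linarith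
    finally show False using q by simp
  qed
  \<comment> \<open>The colour \<open>y j\<close> does not depend on the tuple: one colouring of the
    pages serves all of \<open>P\<close>, so each spine's guess becomes a function of the other
    spines' colours alone.\<close>
  then obtain y where y: "\<And>j. y j < q" "\<And>j. y j \<notin> supp P" "\<And>j. y j \<notin> pg j ` P"
    by metis
  define c where "c x = restrict (case_sum ((!) x) y) (pverts ?G)" for x
  have restrict_c: "restrict (c x) (nbhd ?G v) = restrict (case_sum ((!) x) y) (nbhd ?G v)" for x v
    using nbhd_subset_pverts[of ?G v] by (simp add: c_def Int_absorb1)
  define Q where "Q i = {x \<in> P. g (Inl i) (restrict (c x) (nbhd ?G (Inl i))) = x ! i}" for i
  have len: "length x = k" "distinct x" if "x \<in> P" for x
    using that P by (auto simp: proper_tuples_def)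
  have in_supp: "x ! i \<in> supp P" if "x \<in> P" "i < k" for x i
    using that len[OF that(1)] by (auto simp: supp_def intro!: bexI[of _ x])
  have "saturated i (Q i)" if i: "i < k" for i
    unfolding saturated_def
  proof (rule inj_onI)
    fix x z assume xz: "x \<in> Q i" "z \<in> Q i" "delete_coord i x = delete_coord i z"
    \<comment> \<open>The update form serves twice: it gives agreement away from \<open>i\<close>
      now, and equality of the tuples once their entries at \<open>i\<close> agree.\<close>
    then have upd: "z[i := x ! i] = x"
      using len i by (intro list_update_eq_if_delete_coord_eq) (auto simp: Q_def)
    have "x ! j = z ! j" if "j \<noteq> i" for j
      using that by (metis upd nth_list_update_neq)
    \<comment> \<open>Spine \<open>i\<close> sees the same colours in both colourings, hence makes
      the same guess, which is correct in both.\<close>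
    then have "restrict (c x) (nbhd ?G (Inl i)) = restrict (c z) (nbhd ?G (Inl i))"
      unfolding restrict_c using i by (intro restrict_ext) (auto simp: nbhd_book_graph_spine, metis)
    then have "x ! i = z ! i"
      using xz by (simp add: Q_def)
    then show "x = z"
      using upd by simp
  qed
  moreover have "P = (\<Union>i<k. Q i)"
  proof
    show "P \<subseteq> (\<Union>i<k. Q i)"
    proof
      fix x assume x: "x \<in> P"
      have "c x \<in> pverts ?G \<rightarrow>\<^sub>E {..<q}"
        unfolding c_def restrict_PiE_iff
        using subsetD[OF supp in_supp[OF x]] y(1) by (auto simp: pverts_book_graph)
      moreover have "c x u \<noteq> c x v" if "(u, v) \<in> parcs ?G" for u v
      proof -
        \<comment> \<open>Both orientations occur, since each spine-page edge is a pair of opposite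
          arcs.\<close>
        have "x ! i \<noteq> y j" "y j \<noteq> x ! i" if "i < k" for i j
          using in_supp[OF x that] y(2)[of j] by auto
        then show ?thesis
          using that len[OF x]
          by (auto simp: c_def book_graph_def graph_join_def complete_graph_def
              edgeless_graph_def nth_eq_iff_index_eq)
      qed
      ultimately have "proper_colouring ?G q (c x)"
        by (auto simp: proper_colouring_def)
      then obtain v where v: "v \<in> pverts ?G" "g v (restrict (c x) (nbhd ?G v)) = c x v"
        using win by blast
      show "x \<in> (\<Union>i<k. Q i)"
      proof (cases v)
        case (Inl i)
        then show ?thesis
          using v x by (auto simp: Q_def c_def pverts_book_graph)
      next
        case (Inr j)
        then have j: "j < n"
          using v by (auto simp: pverts_book_graph)
        have "restrict (c x) (nbhd ?G (Inr j))
            = restrict (case_sum ((!) x) (\<lambda>_. 0)) (nbhd ?G (Inr j))"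
          unfolding restrict_c by (intro restrict_ext) (auto simp: nbhd_book_graph_page[OF j])
        then have "pg j x = y j"
          using v j Inr by (simp add: pg_def c_def pverts_book_graph)
        then have "y j \<in> pg j ` P"
          using x by (rule image_eqI[OF sym])
        then show ?thesis
          using y(3)[of j] by simp
      qed
    qed
  qed (auto simp: Q_def)
  ultimately show False
    using ncov coverable_if_covered[of P Q k] by simp
qed

text \<open>Supplies the witness that \<open>GREATEST\<close> needs. Without colours, a nonempty
  graph has no colouring to defeat, and a nonempty neighbourhood has none to serve as the argument
  of a guess function. The bound on \<open>k\<close> gives every spine a neighbour even when there
  are no pages.\<close>

lemma book_graph_winning_strategy_zero:
  assumes "k \<ge> 2"
  shows "winning_strategy (book_graph k n) 0 g"
proof -
  have "0 \<in> {..<k}"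
    using assms by simp
  then have spines: "{..<k} \<noteq> {}"
    by blast
  have "nbhd (book_graph k n) v \<noteq> {}" if "v \<in> pverts (book_graph k n)" for v
  proof (cases v)
    case (Inl i)
    have "(if i = 0 then 1 else 0) \<in> {..<k} - {i}"
      using assms by simp
    then show ?thesis
      using that Inl by (force simp: nbhd_book_graph_spine pverts_book_graph)
  next
    case (Inr j)
    then show ?thesis
      using that spines by (auto simp: nbhd_book_graph_page pverts_book_graph)
  qed
  moreover have "pverts (book_graph k n) \<noteq> {}"
    using spines by (auto simp: pverts_book_graph)
  ultimately show ?thesis
    by (auto simp: winning_strategy_def strategy_def proper_colouring_def PiE_eq_empty_iff)
qed

text \<open>A \<open>GREATEST\<close> over the naturals is attained once some value qualifies and
  the qualifying values are bounded, so \<open>HGP G\<close> itself admits a winning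
  strategy.\<close>

lemma HGP_le:
  assumes "winning_strategy G q\<^sub>0 g\<^sub>0" and "\<And>q g. N < q \<Longrightarrow> \<not> winning_strategy G q g"
  shows "HGP G \<le> N"
proof -
  have "\<exists>g. winning_strategy G (HGP G) g"
    unfolding HGP_def
    by (rule GreatestI_nat[where k = q\<^sub>0 and b = N]) (use assms in \<open>auto simp: not_less[symmetric]\<close>)
  then show ?thesis
    using assms(2) by (meson not_less)
qed

text \<open>Consecutive intervals cut at the partial sums of \<open>m\<close>. Filling an initial
  segment ensures that the blocks lie among the \<open>q\<close> game colours as soon as
  \<open>q\<close> is at least the total.\<close>

lemma disjoint_colour_blocks:
  fixes m :: "nat \<Rightarrow> nat"
  obtains S where "disjoint_family_on S {..<k}" "\<And>i. i < k \<Longrightarrow> finite (S i)"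
    "\<And>i. i < k \<Longrightarrow> card (S i) = m i" "(\<Union>i<k. S i) \<subseteq> {..<\<Sum>i<k. m i}"
proof
  let ?s = "\<lambda>i. \<Sum>j<i. m j"
  let ?S = "\<lambda>i. {?s i..<?s (Suc i)}"
  have mono: "?s i \<le> ?s j" if "i \<le> j" for i j
    using that by (intro sum_mono2) auto
  show "disjoint_family_on ?S {..<k}"
    unfolding disjoint_family_on_def
  proof (intro ballI impI)
    fix i j :: nat assume "i \<noteq> j"
    then have "?s (Suc i) \<le> ?s j \<or> ?s (Suc j) \<le> ?s i"
      using mono by (metis Suc_leI linorder_neqE_nat)
    then show "?S i \<inter> ?S j = {}" by auto
  qed
  show "(\<Union>i<k. ?S i) \<subseteq> {..<?s k}"
  proof
    fix a assume "a \<in> (\<Union>i<k. ?S i)"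
    then obtain i where "i < k" "a < ?s (Suc i)" by auto
    then show "a \<in> {..<?s k}"
      using mono[of "Suc i" k] by simp
  qed
qed auto

theorem theorem1p4:
  fixes k :: nat and m :: "nat \<Rightarrow> nat"
  assumes "k \<ge> 2"
    and "\<And>i. i < k \<Longrightarrow> m i \<ge> 2"
    and "(\<Sum>i<k. 1 / real (m i)) < 1"
  shows "C k \<le> (\<Prod>i<k. m i) + (\<Sum>i<k. m i) \<and>
         (\<forall>n\<ge>1. HGP (book_graph k n) \<le> (\<Prod>i<k. m i) + (\<Sum>i<k. m i))"
proof -
  let ?N = "(\<Prod>i<k. m i) + (\<Sum>i<k. m i)"
  obtain S where S: "disjoint_family_on S {..<k}" "\<And>i. i < k \<Longrightarrow> finite (S i)"
    "\<And>i. i < k \<Longrightarrow> card (S i) = m i" "(\<Union>i<k. S i) \<subseteq> {..<\<Sum>i<k. m i}"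
    using disjoint_colour_blocks[of k m] by blast
  let ?P = "product_config k S"
  have fin: "finite ?P"
    using S(2) by (rule finite_product_config)
  have proper: "?P \<subseteq> proper_tuples k"
    using S(1) by (rule product_config_proper)
  have ncov: "\<not> coverable k ?P"
  proof (rule product_config_not_coverable)
    show "S i \<noteq> {}" if "i < k" for i
      using S(3)[OF that] assms(2)[OF that] by auto
  qed (use S assms(3) in auto)
  have supp: "supp ?P \<subseteq> {..<\<Sum>i<k. m i}"
    using supp_product_config_subset S(4) by (rule order_trans)
  have size: "card ?P + card (supp ?P) \<le> ?N"
    using card_mono[OF _ supp] S(3) by (simp add: card_product_config)
  have "HGP (book_graph k n) \<le> ?N" for n
  proof (rule HGP_le[OF book_graph_winning_strategy_zero[OF assms(1)]])
    show "\<not> winning_strategy (book_graph k n) q g" if q: "?N < q" for q g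
    proof (rule book_graph_no_winning_strategy[OF fin proper ncov])
      show "supp ?P \<subseteq> {..<q}"
        using q by (intro order_trans[OF supp]) simp
      show "card ?P + card (supp ?P) < q"
        using size q by (rule le_less_trans)
    qed
  qed
  then show ?thesis
    using C_le[OF fin proper ncov] size by simp
qed

end
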